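(* Let $m,n$ be integers with $0\le m\le n$ and $(m,n)\neq(0,0)$. Then $$m^2-2mn+n^2-8m-4n=0\quad\text{if and only if}\quad (m,n)\in A,$$ where $$A=\{(m,n): k\in\mathbb{N}_{\ge1}\setminus 3\mathbb{N}_{\ge1},\ m=(k^2-1)/3,\ n=2k+m+2\}.$$
   Context: $\mathbb{N}_{\ge1}$ is the set of positive integers and $3\mathbb{N}_{\ge1}$ the set of positive multiples of three. *)

theory Defs
  imports Complex_Main
begin

text \<open>The quotient in \<open>m = (k\<^sup>2 - 1) / 3\<close> is the exact one, taken in the reals,
  rather than the truncating \<open>div\<close> on the integers.\<close>

definition A :: "(int \<times> int) set" where
  "A = {(m, n). \<exists>k :: nat. k \<in> {1..} - (\<lambda>j. 3 * j) ` {1..} \<and>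
          real_of_int m = ((real k)\<^sup>2 - 1) / 3 \<and> n = 2 * int k + m + 2}"

end

theory Submission
  imports Defs
begin

text \<open>
  In terms of the difference \<open>d = n - m\<close> the equation is linear in \<open>m\<close>, and completing the
  square turns it into \<open>(d - 2)\<^sup>2 = 4 * (3 * m + 1)\<close>. Hence \<open>d\<close> is even, and writing
  \<open>d = 2 * k + 2\<close> leaves \<open>k\<^sup>2 = 3 * m + 1\<close>. Since \<open>d \<ge> 0\<close>, this \<open>k\<close> is at least \<open>-1\<close>; the
  value \<open>0\<close> is excluded by \<open>m\<close> being an integer, and \<open>-1\<close> is exactly the point \<open>(0, 0)\<close>.
  No solution has \<open>k\<close> divisible by three, because \<open>3 * m + 1\<close> is not.
\<close>

lemma conic_iff_square:
  fixes m n :: int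
  shows "m\<^sup>2 - 2 * m * n + n\<^sup>2 - 8 * m - 4 * n = 0 \<longleftrightarrow>
    (\<exists>k. k\<^sup>2 = 3 * m + 1 \<and> n = 2 * k + m + 2)"
proof
  assume "m\<^sup>2 - 2 * m * n + n\<^sup>2 - 8 * m - 4 * n = 0"
  then have sq: "(n - m - 2)\<^sup>2 = 4 * (3 * m + 1)"
    by (simp add: power2_eq_square algebra_simps)
  then have "even ((n - m - 2)\<^sup>2)"
    by simp
  then have "even (n - m - 2)"
    by simp
  then obtain k where k: "n - m - 2 = 2 * k" ..
  with sq have "k\<^sup>2 = 3 * m + 1"
    by (simp add: power_mult_distrib)
  with k show "\<exists>k. k\<^sup>2 = 3 * m + 1 \<and> n = 2 * k + m + 2"
    by (intro exI[of _ k]) simp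
next
  assume "\<exists>k. k\<^sup>2 = 3 * m + 1 \<and> n = 2 * k + m + 2"
  then obtain k where "k\<^sup>2 = 3 * m + 1" and "n = 2 * k + m + 2"
    by blast
  then show "m\<^sup>2 - 2 * m * n + n\<^sup>2 - 8 * m - 4 * n = 0"
    by (simp add: power2_eq_square algebra_simps)
qed

lemma not_three_dvd_if_square_eq:
  fixes k m :: int
  assumes "k\<^sup>2 = 3 * m + 1"
  shows "\<not> 3 dvd k"
proof
  assume "3 dvd k"
  then have "3 dvd 3 * m + 1"
    by (simp flip: assms add: power2_eq_square)
  then show False
    by presburger
qed

text \<open>
  Integrality of the exact quotient \<open>(k\<^sup>2 - 1) / 3\<close> says that \<open>k\<^sup>2\<close> is one more than a
  multiple of three, which no multiple of three satisfies; so membership comes down to a square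
  condition over the integers.
\<close>

lemma mem_A_iff:
  "(m, n) \<in> A \<longleftrightarrow> (\<exists>k\<ge>1. k\<^sup>2 = 3 * m + 1 \<and> n = 2 * k + m + 2)"
proof -
  have quotient: "real_of_int m = ((real k)\<^sup>2 - 1) / 3 \<longleftrightarrow> (int k)\<^sup>2 = 3 * m + 1" for k
  proof -
    have "real_of_int m = ((real k)\<^sup>2 - 1) / 3 \<longleftrightarrow>
        real_of_int ((int k)\<^sup>2) = real_of_int (3 * m + 1)"
      by auto
    then show ?thesis
      by (simp only: of_int_eq_iff)
  qed
  show ?thesis
  proof
    assume "(m, n) \<in> A"
    then obtain k :: nat where "k \<ge> 1" and "(int k)\<^sup>2 = 3 * m + 1" and "n = 2 * int k + m + 2"
      unfolding A_def mem_Collect_eq case_prod_conv quotient by auto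
    then show "\<exists>k\<ge>1. k\<^sup>2 = 3 * m + 1 \<and> n = 2 * k + m + 2"
      by (intro exI[of _ "int k"]) simp
  next
    assume "\<exists>k\<ge>1. k\<^sup>2 = 3 * m + 1 \<and> n = 2 * k + m + 2"
    then obtain k where k: "k \<ge> 1" "k\<^sup>2 = 3 * m + 1" "n = 2 * k + m + 2"
      by blast
    have "nat k \<noteq> 3 * j" for j
    proof
      assume "nat k = 3 * j"
      then have "k = 3 * int j"
        using k(1) by linarith
      with not_three_dvd_if_square_eq[OF k(2)] show False
        by simp
    qed
    with k(1) have "nat k \<in> {1..} - (\<lambda>j. 3 * j) ` {1..}"
      by auto
    with k show "(m, n) \<in> A"
      unfolding A_def mem_Collect_eq case_prod_conv quotient by (auto intro!: exI[of _ "nat k"])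
  qed
qed

theorem theorem3p2:
  fixes m n :: int
  assumes "0 \<le> m" and "m \<le> n" and "(m, n) \<noteq> (0, 0)"
  shows "m\<^sup>2 - 2 * m * n + n\<^sup>2 - 8 * m - 4 * n = 0 \<longleftrightarrow> (m, n) \<in> A"
proof -
  have "k \<ge> 1" if k: "k\<^sup>2 = 3 * m + 1" "n = 2 * k + m + 2" for k
  proof -
    have "k \<ge> -1"
      using k(2) \<open>m \<le> n\<close> by simp
    moreover have "k \<noteq> 0"
      using not_three_dvd_if_square_eq[OF k(1)] by auto
    moreover have "k \<noteq> -1"
      using k \<open>(m, n) \<noteq> (0, 0)\<close> by auto
    ultimately show ?thesis
      by linarith
  qed
  then show ?thesis
    unfolding conic_iff_square mem_A_iff by blast
qed

end
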